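(* There exist absolute constants $c'>0$ and $k_0$ such that for every integer $k\ge k_0$ there are infinitely many positive integers $n$ for which there exists an $n$-vertex $k$-cactus $G$ satisfying $$|E(G)|\ge c'\,\frac{\log k}{\log\log k}\,n.$$ That is, for every sufficiently large $k$ there are infinitely many $n$ for which there is an $n$-vertex $k$-cactus $G$ with $|E(G)|=\Omega\!\left(\frac{\log k}{\log\log k}\,n\right)$.
   Context: All graphs are finite, undirected and simple, and are not required to be connected. A cycle is a connected $2$-regular subgraph. For an integer $k\ge 0$, a $k$-cactus is a graph in which each edge lies on at most $k$ cycles. $E(G)$ is the edge set of $G$. $\log$ is the natural logarithm. *)

theory Defs
  imports Complex_Main
begin

text \<open>A graph is a pair of a vertex set and a set of edges, an edge being an unordered pair,
  i.e. a two-element set of vertices.\<close>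

type_synonym 'a ugraph = "'a set \<times> 'a set set"

abbreviation verts :: "'a ugraph \<Rightarrow> 'a set" where
  "verts G \<equiv> fst G"

abbreviation edges :: "'a ugraph \<Rightarrow> 'a set set" where
  "edges G \<equiv> snd G"

definition simple_graph :: "'a ugraph \<Rightarrow> bool" where
  "simple_graph G \<longleftrightarrow> finite (verts G) \<and> (\<forall>e\<in>edges G. e \<subseteq> verts G \<and> card e = 2)"

definition is_subgraph :: "'a ugraph \<Rightarrow> 'a ugraph \<Rightarrow> bool" where
  "is_subgraph H G \<longleftrightarrow> simple_graph H \<and> verts H \<subseteq> verts G \<and> edges H \<subseteq> edges G"

definition degree :: "'a ugraph \<Rightarrow> 'a \<Rightarrow> nat" where
  "degree G v = card {e \<in> edges G. v \<in> e}"

definition regular :: "nat \<Rightarrow> 'a ugraph \<Rightarrow> bool" where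
  "regular d G \<longleftrightarrow> (\<forall>v\<in>verts G. degree G v = d)"

definition connected_graph :: "'a ugraph \<Rightarrow> bool" where
  "connected_graph G \<longleftrightarrow> verts G \<noteq> {} \<and>
     (\<forall>u\<in>verts G. \<forall>v\<in>verts G. (u, v) \<in> {(x, y). {x, y} \<in> edges G}\<^sup>*)"

text \<open>Cycles are subgraphs, not vertex sequences: there is no base point and no orientation,
  so each cycle is counted once.\<close>

definition is_cycle_of :: "'a ugraph \<Rightarrow> 'a ugraph \<Rightarrow> bool" where
  "is_cycle_of C G \<longleftrightarrow> is_subgraph C G \<and> connected_graph C \<and> regular 2 C"

definition k_cactus :: "nat \<Rightarrow> 'a ugraph \<Rightarrow> bool" where
  "k_cactus k G \<longleftrightarrow> simple_graph G \<and>
     (\<forall>e\<in>edges G. card {C. is_cycle_of C G \<and> e \<in> edges C} \<le> k)"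

text \<open>Since \<open>card\<close> is \<open>0\<close> on infinite sets, it matters that the sets counted are finite.\<close>

lemma finite_edges: "simple_graph G \<Longrightarrow> finite (edges G)"
  by (rule finite_subset[of _ "Pow (verts G)"]) (auto simp: simple_graph_def)

lemma finite_cycles_of:
  assumes "simple_graph G"
  shows "finite {C. is_cycle_of C G}"
proof (rule finite_subset)
  show "{C. is_cycle_of C G} \<subseteq> Pow (verts G) \<times> Pow (edges G)"
    by (auto simp: is_cycle_of_def is_subgraph_def)
  show "finite (Pow (verts G) \<times> Pow (edges G))"
    using assms finite_edges[OF assms] by (auto simp: simple_graph_def)
qed

end

theory Submission
  imports Defs "HOL-Real_Asymp.Real_Asymp"
begin

text \<open>Take disjoint copies of the complete graph on \<open>t\<close> vertices. A cycle is connected, so it stays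
  inside one copy; it is determined by its edge set, which consists of at most \<open>2t\<close> of the at most
  \<open>t\<^sup>2\<close> edges of that copy. Hence an edge lies on at most \<open>t\<^bsup>4t\<^esup>\<close> cycles, and this crude bound allows
  \<open>t\<close> to be about \<open>ln k / (4 ln (ln k))\<close>, while there are \<open>(t - 1) / 2\<close> edges per vertex.\<close>

text \<open>Degree 2 rules out isolated vertices, the only part of a graph that its edge set does
  not show. This is what makes \<open>edges\<close> injective on cycles.\<close>

lemma verts_eq_Union_edges:
  assumes "simple_graph C" "regular 2 C"
  shows "verts C = \<Union>(edges C)"
proof
  show "\<Union>(edges C) \<subseteq> verts C"
    using assms(1) by (auto simp: simple_graph_def)
  show "verts C \<subseteq> \<Union>(edges C)"
  proof
    fix v assume "v \<in> verts C"
    then have "card {e \<in> edges C. v \<in> e} = 2"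
      using assms(2) by (simp add: regular_def degree_def)
    then have "{e \<in> edges C. v \<in> e} \<noteq> {}"
      by (metis card.empty zero_neq_numeral)
    then show "v \<in> \<Union>(edges C)" by auto
  qed
qed

text \<open>Union bound over the stars of the vertices. Each edge is counted at both ends, so a
  factor 2 is lost, which the crude count can afford.\<close>

lemma card_edges_regular_le:
  assumes "simple_graph C" "regular d C"
  shows "card (edges C) \<le> d * card (verts C)"
proof -
  have "e \<noteq> {}" if "e \<in> edges C" for e
    using assms(1) that by (auto simp: simple_graph_def)
  then have "edges C = (\<Union>v\<in>verts C. {e \<in> edges C. v \<in> e})"
    using assms(1) by (fastforce simp: simple_graph_def)
  then have "card (edges C) \<le> (\<Sum>v\<in>verts C. card {e \<in> edges C. v \<in> e})"
    using card_UN_le[of "verts C" "\<lambda>v. {e \<in> edges C. v \<in> e}"] assms(1)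
    by (simp add: simple_graph_def)
  also have "\<dots> = (\<Sum>v\<in>verts C. d)"
    using assms(2) by (intro sum.cong) (auto simp: regular_def degree_def)
  finally show ?thesis by (simp add: mult.commute)
qed

text \<open>Pad an enumeration by repeating one element. Sets of size at most \<open>n\<close> can
  then be counted through lists of length exactly \<open>n\<close>.\<close>

lemma list_of_length_enumerating:
  assumes "finite A" "A \<noteq> {}" "card A \<le> n"
  shows "\<exists>xs. set xs = A \<and> length xs = n"
proof -
  obtain xs where xs: "set xs = A" "distinct xs"
    using finite_distinct_list[OF assms(1)] by blast
  obtain a where "a \<in> A" using assms(2) by blast
  then have "set (xs @ replicate (n - card A) a) = A"
    using xs by (auto simp: set_replicate_conv_if)
  moreover have "length (xs @ replicate (n - card A) a) = n"
    using xs assms(3) distinct_card[of xs] by simp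
  ultimately show ?thesis by blast
qed

text \<open>Each member of \<open>S\<close> is encoded by a list of \<open>2 * card B\<close> pairs
  from \<open>B\<close> that enumerates its edges. There are at most \<open>card B ^ 2\<close>
  choices per entry.\<close>

lemma card_connected_2_regular_le:
  assumes "finite B"
    and S: "\<And>C. C \<in> S \<Longrightarrow> simple_graph C \<and> connected_graph C \<and> regular 2 C \<and> verts C \<subseteq> B"
  shows "card S \<le> card B ^ (4 * card B)"
proof -
  let ?P = "{e. e \<subseteq> B \<and> card e = 2}"
  let ?L = "{xs. set xs \<subseteq> ?P \<and> length xs = 2 * card B}"
  have finP: "finite ?P" using assms(1) by simp
  have "card ?P = card B choose 2"
    using n_subsets[OF assms(1)] by simp
  also have "\<dots> \<le> card B ^ 2"
    by (cases "2 \<le> card B") (simp_all add: binomial_le_pow binomial_eq_0)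
  finally have cardP: "card ?P \<le> card B ^ 2" .
  have inj: "inj_on edges S"
  proof (rule inj_onI)
    fix C D assume "C \<in> S" "D \<in> S" "edges C = edges D"
    then show "C = D"
      using S[of C] S[of D] verts_eq_Union_edges[of C] verts_eq_Union_edges[of D]
      by (intro prod_eqI) simp_all
  qed
  have sub: "edges ` S \<subseteq> set ` ?L"
  proof
    fix F assume "F \<in> edges ` S"
    then obtain C where C: "C \<in> S" "F = edges C" by blast
    note SC = S[OF C(1)]
    \<comment> \<open>Padding needs an element: \<open>connected_graph\<close> excludes the graph
      without vertices, and every vertex lies on an edge.\<close>
    have "F \<noteq> {}"
      using SC verts_eq_Union_edges[of C] C(2) by (auto simp: connected_graph_def)
    moreover have "finite F" using SC finite_edges C(2) by blast
    moreover have "card F \<le> 2 * card B"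
      using card_edges_regular_le[of C 2] SC card_mono[OF assms(1), of "verts C"] C(2) by force
    moreover have "F \<subseteq> ?P"
      using SC C(2) by (auto simp: simple_graph_def)
    ultimately show "F \<in> set ` ?L"
      using list_of_length_enumerating[of F "2 * card B"] by blast
  qed
  have finL: "finite ?L" using finite_lists_length_eq[OF finP] .
  have "card S = card (edges ` S)" using card_image[OF inj] by simp
  also have "\<dots> \<le> card (set ` ?L)" using finL sub by (intro card_mono) auto
  also have "\<dots> \<le> card ?L" using card_image_le[OF finL] .
  also have "\<dots> = card ?P ^ (2 * card B)" using card_lists_length_eq[OF finP] .
  also have "\<dots> \<le> (card B ^ 2) ^ (2 * card B)" using cardP by (rule power_mono) simp
  also have "\<dots> = card B ^ (4 * card B)" by (simp flip: power_mult)
  finally show ?thesis .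
qed

text \<open>A labelling that is constant along edges is constant along paths. It is applied with
  \<open>f\<close> the index of the block, to confine a cycle to one clique.\<close>

lemma connected_graph_subset_block:
  assumes "connected_graph C" "v \<in> verts C"
    and same: "\<And>x y. {x, y} \<in> edges C \<Longrightarrow> f x = f y"
  shows "verts C \<subseteq> {u. f u = f v}"
proof
  fix u assume "u \<in> verts C"
  then have "(v, u) \<in> {(x, y). {x, y} \<in> edges C}\<^sup>*"
    using assms(1,2) by (auto simp: connected_graph_def)
  then have "f v = f u"
    by (induction rule: rtrancl_induct) (auto dest: same)
  then show "u \<in> {u. f u = f v}" by simp
qed

text \<open>Consecutive intervals are chosen so that, for positive \<open>t\<close>, the block of a
  vertex \<open>v\<close> is read off as \<open>v div t\<close>.\<close>

definition block :: "nat \<Rightarrow> nat \<Rightarrow> nat set" where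
  "block t q = {q * t..<q * t + t}"

definition disjoint_cliques :: "nat \<Rightarrow> nat \<Rightarrow> nat ugraph" where
  "disjoint_cliques t m = ({..<m * t}, \<Union>q<m. {e. e \<subseteq> block t q \<and> card e = 2})"

lemma mem_block_iff: "t > 0 \<Longrightarrow> v \<in> block t q \<longleftrightarrow> v div t = q"
proof
  assume "t > 0" "v \<in> block t q"
  then show "v div t = q"
    by (intro div_nat_eqI) (auto simp: block_def mult.commute)
next
  assume "t > 0" "v div t = q"
  then show "v \<in> block t q"
    by (auto simp: block_def dividend_less_div_times add.commute)
qed

lemma card_block [simp]: "card (block t q) = t"
  and finite_block [simp]: "finite (block t q)"
  by (simp_all add: block_def)

lemma simple_graph_disjoint_cliques: "simple_graph (disjoint_cliques t m)"
proof -
  have "v < m * t" if "q < m" "v \<in> block t q" for v q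
  proof -
    have "v < (q + 1) * t" using that(2) by (simp add: block_def)
    also have "\<dots> \<le> m * t" using that(1) by (intro mult_right_mono) auto
    finally show ?thesis .
  qed
  then show ?thesis by (auto simp: simple_graph_def disjoint_cliques_def)
qed

lemma card_verts_disjoint_cliques: "card (verts (disjoint_cliques t m)) = m * t"
  by (simp add: disjoint_cliques_def)

lemma card_edges_disjoint_cliques:
  assumes "t > 0"
  shows "card (edges (disjoint_cliques t m)) = m * (t choose 2)"
proof -
  have "card (\<Union>q<m. {e. e \<subseteq> block t q \<and> card e = 2})
      = (\<Sum>q<m. card {e. e \<subseteq> block t q \<and> card e = 2})"
  proof (intro card_UN_disjoint ballI impI)
    fix p q :: nat assume "p \<noteq> q"
    then have "block t p \<inter> block t q = {}" using mem_block_iff[OF assms] by auto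
    \<comment> \<open>An edge inside two disjoint blocks would be empty.\<close>
    then have "\<not> (e \<subseteq> block t p \<and> e \<subseteq> block t q)" if "card e = 2" for e
      using that by (metis Int_greatest card.empty subset_empty zero_neq_numeral)
    then show "{e. e \<subseteq> block t p \<and> card e = 2} \<inter> {e. e \<subseteq> block t q \<and> card e = 2} = {}"
      by blast
  qed auto
  also have "\<dots> = m * (t choose 2)" by (simp add: n_subsets)
  finally show ?thesis by (simp add: disjoint_cliques_def)
qed

lemma k_cactus_disjoint_cliques:
  assumes "t > 0" "t ^ (4 * t) \<le> k"
  shows "k_cactus k (disjoint_cliques t m)"
  unfolding k_cactus_def
proof (intro conjI ballI simple_graph_disjoint_cliques)
  let ?G = "disjoint_cliques t m"
  fix e assume "e \<in> edges ?G"
  then have "e \<noteq> {}" by (auto simp: disjoint_cliques_def)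
  \<comment> \<open>Every cycle through \<open>e\<close> contains \<open>v\<close>, so
    \<open>v\<close> selects the one block in which all these cycles are counted.\<close>
  then obtain v where v: "v \<in> e" by blast
  have same: "x div t = y div t" if xy: "{x, y} \<in> edges ?G" for x y
  proof -
    from xy obtain q where "x \<in> block t q" "y \<in> block t q"
      by (auto simp: disjoint_cliques_def)
    then show ?thesis using mem_block_iff[OF assms(1)] by simp
  qed
  have "card {C. is_cycle_of C ?G \<and> e \<in> edges C} \<le> card (block t (v div t)) ^ (4 * card (block t (v div t)))"
  proof (rule card_connected_2_regular_le)
    fix C assume "C \<in> {C. is_cycle_of C ?G \<and> e \<in> edges C}"
    then have C: "simple_graph C" "edges C \<subseteq> edges ?G" "connected_graph C" "regular 2 C" "e \<in> edges C"
      by (auto simp: is_cycle_of_def is_subgraph_def)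
    then have "v \<in> verts C" using v by (auto simp: simple_graph_def)
    moreover have "x div t = y div t" if "{x, y} \<in> edges C" for x y
      using same C(2) that by blast
    ultimately have "verts C \<subseteq> {u. u div t = v div t}"
      by (rule connected_graph_subset_block[OF C(3)])
    then show "simple_graph C \<and> connected_graph C \<and> regular 2 C \<and> verts C \<subseteq> block t (v div t)"
      using C mem_block_iff[OF assms(1)] by auto
  qed simp
  then show "card {C. is_cycle_of C ?G \<and> e \<in> edges C} \<le> k" using assms(2) by simp
qed

text \<open>With L = ln k and t the floor of L / (4 ln L), one has t \<le> L, hence 4 t ln t \<le> 4
  t ln L \<le> L, which is the logarithm of the required bound.\<close>

lemma exists_clique_size:
  assumes "k > 0" and lnln: "ln (ln (real k)) \<ge> 1" and ratio: "ln (real k) / ln (ln (real k)) \<ge> 16"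
  shows "\<exists>t>0. t ^ (4 * t) \<le> k \<and> (real t - 1) / 2 \<ge> 1 / 16 * (ln (real k) / ln (ln (real k)))"
proof -
  define L where "L = ln (real k)"
  define t where "t = nat \<lfloor>L / (4 * ln L)\<rfloor>"
  have lnL: "ln L \<ge> 1" and LL: "L / ln L \<ge> 16" using lnln ratio by (simp_all add: L_def)
  have L: "L > 0" using LL lnL by (smt (verit) divide_nonpos_nonneg)
  have quarter: "L / (4 * ln L) = (L / ln L) / 4" by simp
  have upper: "real t \<le> L / (4 * ln L)" and lower: "real t \<ge> L / (4 * ln L) - 1"
    unfolding t_def using LL quarter by linarith+
  have t: "real t > 0" using lower quarter LL by linarith
  have "L > 1" using ln_gt_zero_iff[OF L] lnL by linarith
  then have "L / (4 * ln L) \<le> L / 1" using lnL by (intro divide_left_mono) auto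
  then have "ln (real t) \<le> ln L" using upper t by simp
  then have "real t * ln (real t) \<le> L / (4 * ln L) * ln L"
    using upper t L lnL by (intro mult_mono') (auto simp: field_simps)
  also have "\<dots> = L / 4" using lnL by simp
  finally have "4 * real t * ln (real t) \<le> L" by simp
  then have "ln (real (t ^ (4 * t))) \<le> ln (real k)"
    using t by (simp add: ln_realpow L_def)
  then have "real (t ^ (4 * t)) \<le> real k"
    using t assms(1) by (subst (asm) ln_le_cancel_iff) simp_all
  then have "t ^ (4 * t) \<le> k" by (simp only: of_nat_le_iff)
  \<comment> \<open>Origin of both constants 16: rounding costs 1 and the degree t - 1 another 1,
    leaving x/8 - 1, which is at least x/16 exactly when x \<ge> 16.\<close>
  moreover have "(r - 1) / 2 \<ge> 1 / 16 * x" if "r \<ge> x / 4 - 1" "x \<ge> 16" for r x :: real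
    using that by simp
  then have "(real t - 1) / 2 \<ge> 1 / 16 * (L / ln L)"
    using lower LL unfolding quarter by blast
  ultimately show ?thesis using t unfolding L_def of_nat_0_less_iff by blast
qed

theorem proposition4p2:
  shows "\<exists>c'::real. \<exists>k\<^sub>0::nat. c' > 0 \<and>
    (\<forall>k::nat. k \<ge> k\<^sub>0 \<longrightarrow>
      infinite {n::nat. n > 0 \<and>
        (\<exists>G :: nat ugraph. k_cactus k G \<and> card (verts G) = n \<and>
          real (card (edges G)) \<ge> c' * (ln (real k) / ln (ln (real k))) * real n)})"
proof -
  have "\<forall>\<^sub>F k::nat in at_top. ln (ln (real k)) \<ge> 1" by real_asymp
  moreover have "\<forall>\<^sub>F k::nat in at_top. ln (real k) / ln (ln (real k)) \<ge> 16" by real_asymp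
  ultimately have "\<forall>\<^sub>F k::nat in at_top. k > 0 \<and> ln (ln (real k)) \<ge> 1
      \<and> ln (real k) / ln (ln (real k)) \<ge> 16"
    using eventually_gt_at_top[of "0::nat"] by eventually_elim simp
  then obtain k\<^sub>0 :: nat where k\<^sub>0: "\<And>k. k \<ge> k\<^sub>0 \<Longrightarrow> k > 0 \<and> ln (ln (real k)) \<ge> 1
      \<and> ln (real k) / ln (ln (real k)) \<ge> 16"
    unfolding eventually_sequentially by blast
  have "infinite {n::nat. n > 0 \<and> (\<exists>G :: nat ugraph. k_cactus k G \<and> card (verts G) = n \<and>
          real (card (edges G)) \<ge> 1 / 16 * (ln (real k) / ln (ln (real k))) * real n)}"
    (is "infinite ?N") if k: "k \<ge> k\<^sub>0" for k
  proof -
    obtain t where t: "t > 0" "t ^ (4 * t) \<le> k"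
      "(real t - 1) / 2 \<ge> 1 / 16 * (ln (real k) / ln (ln (real k)))"
      using exists_clique_size[of k] k\<^sub>0[OF k] by blast
    \<comment> \<open>The clique size \<open>t\<close> depends on \<open>k\<close> alone; varying
      the number \<open>m\<close> of copies gives infinitely many orders with the same edge
      density.\<close>
    have "m * t \<in> ?N" if "m > 0" for m
    proof -
      have "real (t choose 2) = real t * (real t - 1) / 2"
        using t(1) by (simp add: choose_two real_of_nat_div of_nat_diff)
      then have "real (card (edges (disjoint_cliques t m))) = (real t - 1) / 2 * real (m * t)"
        by (simp add: card_edges_disjoint_cliques[OF t(1)])
      also have "\<dots> \<ge> 1 / 16 * (ln (real k) / ln (ln (real k))) * real (m * t)"
        using t(3) by (rule mult_right_mono) simp
      finally show ?thesis
        using that t(1) k_cactus_disjoint_cliques[OF t(1,2), of m] card_verts_disjoint_cliques[of t m]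
        by (intro CollectI conjI exI[of _ "disjoint_cliques t m"]) auto
    qed
    then have "(\<lambda>m. m * t) ` {0<..} \<subseteq> ?N" by auto
    moreover have "infinite ((\<lambda>m. m * t) ` {0<..})"
      using t(1) infinite_Ioi[of "0::nat"] by (subst finite_image_iff) (auto simp: inj_on_def)
    ultimately show ?thesis using finite_subset by blast
  qed
  then show ?thesis
    by (intro exI[of _ "1 / 16"] exI[of _ k\<^sub>0]) auto
qed

end
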